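(* Let $\mathcal{D}\subset\mathbb{R}^2$ be a simply connected domain, let $g$ be the smooth, positive definite metric tensor on $\mathcal{D}$ of a smooth mapping $f$ (that is, $g(x)=J(x)^TJ(x)$, where $J=\nabla f$ is the Jacobian matrix of $f$, non-singular on $\mathcal{D}$), and let $\widetilde{\mathcal{V}},\widetilde{\mathcal{H}}:\mathcal{D}\to\mathbb{R}$ be smooth functions. Let $u=(u_1,u_2)^T$ be the planar vector field on $\mathcal{D}$ given by $$u(x)=-g^{-1}(x)\nabla\widetilde{\mathcal{V}}(x)\pm\frac{1}{\sqrt{\det g(x)}}\,S\nabla\widetilde{\mathcal{H}}(x),\qquad S=\begin{pmatrix}0&1\\-1&0\end{pmatrix},$$ where the sign $\pm$ is the sign of $\det J$. If the scalar potential $\widetilde{\mathcal{V}}$, or its negative $-\widetilde{\mathcal{V}}$, is a strictly subharmonic function (with respect to the metric $g$) throughout $\mathcal{D}$, then the system $\dot{x}=u(x)$ has no closed orbits contained entirely in $\mathcal{D}$.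
   Context: All quantities are real. $\nabla=(\partial/\partial x_1,\partial/\partial x_2)^T$ is the vector of partial derivatives. A smooth function $\psi$ on $\mathcal{D}$ is strictly subharmonic with respect to $g$ if its Laplace--Beltrami operator has strict sign: $\frac{1}{\sqrt{\det g(x)}}\nabla\cdot\big[\sqrt{\det g(x)}\,g^{-1}(x)\nabla\psi(x)\big]>0$ for all $x\in\mathcal{D}$. (Since the hypothesis allows either $\widetilde{\mathcal{V}}$ or $-\widetilde{\mathcal{V}}$, the sign convention for the Laplace--Beltrami operator is immaterial.) An orbit is a curve in phase space along which a trajectory of the steady system runs; a closed orbit is the closed curve traced by a non-constant periodic trajectory (fixed points are not counted as closed orbits). *)

theory Defs
  imports "HOL-Analysis.Analysis"
begin

text \<open>Smoothness is meant on open sets: all iterated directional derivatives exist, are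
  differentiable and continuous.\<close>

primrec C_k_on :: "nat \<Rightarrow> ('a::real_normed_vector \<Rightarrow> 'b::real_normed_vector) \<Rightarrow> 'a set \<Rightarrow> bool" where
  "C_k_on 0 f D \<longleftrightarrow> continuous_on D f"
| "C_k_on (Suc k) f D \<longleftrightarrow>
     (\<forall>x\<in>D. f differentiable (at x)) \<and>
     (\<forall>v. C_k_on k (\<lambda>x. frechet_derivative f (at x) v) D)"

definition smooth_on :: "('a::real_normed_vector \<Rightarrow> 'b::real_normed_vector) \<Rightarrow> 'a set \<Rightarrow> bool" where
  "smooth_on f D \<longleftrightarrow> (\<forall>k. C_k_on k f D)"

text \<open>Like \<^const>\<open>jacobian\<close>, this uses the total derivative; it is the usual partial derivative
  wherever \<open>\<psi>\<close> is differentiable.\<close>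

definition partial_deriv :: "'n \<Rightarrow> (real^'n::finite \<Rightarrow> real) \<Rightarrow> real^'n \<Rightarrow> real" where
  "partial_deriv i \<psi> x = frechet_derivative \<psi> (at x) (axis i 1)"

definition grad :: "(real^'n::finite \<Rightarrow> real) \<Rightarrow> real^'n \<Rightarrow> real^'n" where
  "grad \<psi> x = (\<chi> i. partial_deriv i \<psi> x)"

definition divergence :: "(real^'n::finite \<Rightarrow> real^'n) \<Rightarrow> real^'n \<Rightarrow> real" where
  "divergence F x = (\<Sum>i\<in>UNIV. partial_deriv i (\<lambda>y. F y $ i) x)"

definition laplace_beltrami ::
    "(real^'n::finite \<Rightarrow> real^'n^'n) \<Rightarrow> (real^'n \<Rightarrow> real) \<Rightarrow> real^'n \<Rightarrow> real" where
  "laplace_beltrami g \<psi> x =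
     1 / sqrt (det (g x)) *
     divergence (\<lambda>y. sqrt (det (g y)) *\<^sub>R (matrix_inv (g y) *v grad \<psi> y)) x"

text \<open>Intended for \<open>\<psi>\<close> smooth on \<open>D\<close>.\<close>

definition strictly_subharmonic_on ::
    "(real^'n::finite) set \<Rightarrow> (real^'n \<Rightarrow> real^'n^'n) \<Rightarrow> (real^'n \<Rightarrow> real) \<Rightarrow> bool" where
  "strictly_subharmonic_on D g \<psi> \<longleftrightarrow> (\<forall>x\<in>D. laplace_beltrami g \<psi> x > 0)"

definition S_mat :: "real^2^2" where
  "S_mat = vector [vector [0, 1], vector [-1, 0]]"

definition closed_orbit ::
    "('a::real_normed_vector \<Rightarrow> 'a) \<Rightarrow> 'a set \<Rightarrow> bool" where
  "closed_orbit u C \<longleftrightarrow>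
     (\<exists>\<gamma> T. (\<forall>t. (\<gamma> has_vector_derivative u (\<gamma> t)) (at t)) \<and>
            T > 0 \<and> (\<forall>t. \<gamma> (t + T) = \<gamma> t) \<and>
            \<not> \<gamma> constant_on UNIV \<and>
            C = range \<gamma>)"

end

theory Submission
  imports Defs "HOL-Complex_Analysis.Complex_Analysis"
begin

text \<open>
  With \<open>\<rho> = sqrt (det g)\<close>, the field \<open>\<rho> u\<close> has divergence \<open>- \<rho>\<close> times the Laplace--Beltrami operator
  of \<open>V\<close>, because \<open>S \<nabla>H\<close> is divergence-free and \<open>sgn (det J)\<close> is locally constant. So the claim is
  an instance of the Bendixson--Dulac criterion for a field \<open>F = \<plusminus>\<rho> u\<close> of positive divergence.

  The criterion is proved without Green's theorem. A closed orbit bounds a region \<open>R\<close>, by uniqueness of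
  solutions and the Jordan curve theorem, and \<open>R\<close> lies in \<open>D\<close> because \<open>D\<close> is simply connected. The Euler
  step \<open>x \<mapsto> x + h F x\<close> increases the area of \<open>R\<close> by at least a constant times \<open>h\<close>. On the other
  hand \<open>F\<close> is tangent to the boundary, so the image of \<open>R\<close> stays in the union of \<open>R\<close> and an
  \<open>o(h)\<close>-neighbourhood of the rectifiable boundary curve, whose area is \<open>o(h)\<close>.
\<close>


no_notation fps_nth (infixl \<open>$\<close> 75)

section \<open>The area argument\<close>

text \<open>Sample the curve at about \<open>M * T / r\<close> equally spaced parameters. Discs of
  radius \<open>2 * r\<close> around the samples cover the \<open>r\<close>-neighbourhood, and each
  has area of order \<open>r * r\<close>, so the total is of order \<open>r\<close>. The bound is
  stated for a measurable superset \<open>B\<close>, which spares a proof that the neighbourhood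
  itself is measurable.\<close>

lemma lipschitz_curve_neighbourhood_measure:
  fixes \<gamma> :: "real \<Rightarrow> real^2"
  assumes "M-lipschitz_on {0..T} \<gamma>" and "T \<ge> 0"
  obtains C where "C > 0"
    "\<And>r. \<lbrakk>0 < r; r \<le> 1\<rbrakk> \<Longrightarrow>
       \<exists>B\<in>lmeasurable. measure lebesgue B \<le> C * r \<and> (\<Union>t\<in>{0..T}. cball (\<gamma> t) r) \<subseteq> B"
proof
  \<comment> \<open>At most \<open>M * T / r + 2\<close> discs of area \<open>4 * pi * r * r\<close>
    occur, and \<open>r \<le> 1\<close>.\<close>
  define C where "C = (M * T + 2) * pi * 4"
  have M: "M \<ge> 0" using assms(1) by (rule lipschitz_on_nonneg)
  show "C > 0" using M assms(2) by (simp add: C_def add_nonneg_pos)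
  fix r :: real assume r: "0 < r" "r \<le> 1"
  \<comment> \<open>The added 1 keeps \<open>n\<close> positive when
    \<open>M * T = 0\<close>.\<close>
  define n where "n = nat \<lceil>M * T / r\<rceil> + 1"
  define B where "B = (\<Union>k\<in>{..<n}. cball (\<gamma> (real k * T / n)) (2 * r))"
  have n: "M * T / r \<le> n" "real n \<le> M * T / r + 2" "n > 0"
    using M assms(2) r unfolding n_def by (simp_all add: le_nat_iff, linarith+)
  have "B \<in> lmeasurable" unfolding B_def by (intro fmeasurable.finite_UN) auto
  moreover have "measure lebesgue B \<le> C * r"
  proof -
    have "measure lebesgue B \<le> (\<Sum>k<n. measure lebesgue (cball (\<gamma> (real k * T / n)) (2 * r)))"
      unfolding B_def by (intro measure_UNION_le) auto
    also have "\<dots> = n * (pi * (4 * r\<^sup>2))"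
      using r by (simp add: content_cball unit_ball_vol_2 power2_eq_square)
    also have "\<dots> \<le> (M * T / r + 2) * (pi * (4 * r\<^sup>2))"
      using n by (intro mult_right_mono) auto
    also have "\<dots> = (M * T + 2 * r) * pi * 4 * r"
      using r by (simp add: field_simps power2_eq_square)
    also have "\<dots> \<le> C * r"
      unfolding C_def using r by (intro mult_right_mono) auto
    finally show ?thesis .
  qed
  moreover have "(\<Union>t\<in>{0..T}. cball (\<gamma> t) r) \<subseteq> B"
  proof safe
    fix t y assume t: "t \<in> {0..T}" and y: "y \<in> cball (\<gamma> t) r"
    show "y \<in> B"
    proof -
      \<comment> \<open>The sample just before \<open>t\<close> serves. For \<open>t = T\<close>
        rounding down would give the index \<open>n\<close>, which is out of range, so
        \<open>n - 1\<close> is taken.\<close>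
      obtain k where k: "k < n" "\<bar>t - real k * T / n\<bar> \<le> T / n"
      proof (cases "t = T")
        case True
        show ?thesis using n(3) by (intro that[of "n - 1"]) (auto simp: True of_nat_diff field_simps assms)
      next
        case False
        then have tT: "0 \<le> t" "t < T" using t by auto
        define k where "k = nat \<lfloor>t * n / T\<rfloor>"
        have 1: "real k \<le> t * n / T" "t * n / T < real k + 1"
          using tT unfolding k_def by (auto simp: of_nat_nat)
        have "t * n / T < n" using tT n(3) by (simp add: field_simps)
        then have "k < n" using 1 by linarith
        moreover have "real k * T / n \<le> t" "t \<le> (real k + 1) * T / n"
          using 1 tT n(3) by (auto simp: field_simps)
        ultimately show ?thesis by (intro that[of k]) (use tT in \<open>auto simp: abs_le_iff distrib_right add_divide_distrib\<close>)
      qed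
      have "real k * T / n \<in> {0..T}"
        using k(1) n(3) assms(2) by (auto simp: field_simps mult_left_mono)
      then have "dist (\<gamma> t) (\<gamma> (real k * T / n)) \<le> M * \<bar>t - real k * T / n\<bar>"
        using lipschitz_onD[OF assms(1) t] by (simp add: dist_real_def)
      also have "\<dots> \<le> M * (T / n)" using k(2) M by (rule mult_left_mono)
      also have "\<dots> \<le> r" using n r by (simp add: field_simps)
      finally have "dist (\<gamma> (real k * T / n)) y \<le> 2 * r"
        using y dist_triangle[of "\<gamma> (real k * T / n)" y "\<gamma> t"] by (simp add: dist_commute)
      then show ?thesis using k(1) by (auto simp: B_def)
    qed
  qed
  ultimately show "\<exists>B\<in>lmeasurable. measure lebesgue B \<le> C * r \<and> (\<Union>t\<in>{0..T}. cball (\<gamma> t) r) \<subseteq> B"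
    by blast
qed

text \<open>Continuously differentiable fields are locally Lipschitz, and on a compact set a local
  Lipschitz condition becomes a global one. The dummy time variable only fits the notion
  \<open>local_lipschitz\<close>, which is made for time-dependent fields.\<close>

lemma C1_lipschitz_on_compact:
  fixes F :: "'a::{banach,heine_borel} \<Rightarrow> 'a" and F' :: "'a \<Rightarrow> 'a \<Rightarrow>\<^sub>L 'a"
  assumes "open D" "compact K" "K \<subseteq> D"
    and "\<And>x. x \<in> D \<Longrightarrow> (F has_derivative F' x) (at x)" "continuous_on D F'"
  obtains L where "L-lipschitz_on K F"
proof -
  have "local_lipschitz UNIV D (\<lambda>t::real. F)"
    by (rule c1_implies_local_lipschitz[where f' = "\<lambda>(t, x). F' x"])
      (auto simp: assms case_prod_beta intro!: continuous_intros continuous_on_compose2[OF assms(5)])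
  then have "local_lipschitz {0} K (\<lambda>t::real. F)"
    by (rule local_lipschitz_subset) (use assms in auto)
  from local_lipschitz_compact_implies_lipschitz[OF this \<open>compact K\<close>]
  show ?thesis using that by (metis compact_sing continuous_on_const singletonI)
qed

text \<open>Applied to the Jacobian matrix of \<open>F\<close>, this expands the area distortion of
  the Euler step; the coefficient of \<open>h\<close> is the divergence of \<open>F\<close>.\<close>

lemma det_one_plus_scaleR_2:
  fixes A :: "real^2^2"
  shows "det (mat 1 + h *\<^sub>R A) = 1 + h * (\<Sum>i\<in>UNIV. A $ i $ i) + h\<^sup>2 * det A"
  by (simp add: det_2 sum_2 mat_def power2_eq_square algebra_simps)

lemma periodic_int:
  fixes \<gamma> :: "real \<Rightarrow> 'a"
  assumes "\<And>t. \<gamma> (t + T) = \<gamma> t"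
  shows "\<gamma> (t + of_int k * T) = \<gamma> t"
proof (induction k rule: int_induct[where k = 0])
  case (step1 i)
  then show ?case using assms[of "t + of_int i * T"] by (simp add: algebra_simps)
next
  case (step2 i)
  then show ?case using assms[of "t + of_int (i - 1) * T"] by (simp add: algebra_simps)
qed simp

lemma periodic_range:
  fixes \<gamma> :: "real \<Rightarrow> 'a"
  assumes "\<And>t. \<gamma> (t + T) = \<gamma> t" "T > 0"
  shows "range \<gamma> = \<gamma> ` {0..<T}"
proof safe
  fix t
  have "t + of_int (- \<lfloor>t / T\<rfloor>) * T \<in> {0..<T}"
    using assms(2) floor_divide_lower[of T t] floor_divide_upper[of T t] by (auto simp: algebra_simps)
  then show "\<gamma> t \<in> \<gamma> ` {0..<T}"
    using periodic_int[where \<gamma> = \<gamma> and T = T and t = t and k = "- \<lfloor>t / T\<rfloor>", OF assms(1)] by (metis image_eqI)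
qed auto

text \<open>The image of \<open>R\<close> under a short Euler step of \<open>F\<close> has area at
  least \<open>a + a * h * m / 2\<close> and at most \<open>a + a * h * m / 4\<close>, where
  \<open>a\<close> is the area of \<open>R\<close> and \<open>m\<close> a lower bound of the
  divergence. Tangency of \<open>F\<close> to the curve is expressed by the continuous factor
  \<open>\<rho>\<close>, whose sign is arbitrary, so that rescaled and reversed fields are
  covered.\<close>

lemma no_region_bounded_by_integral_curve:
  fixes D R :: "(real^2) set" and F :: "real^2 \<Rightarrow> real^2"
    and F' :: "real^2 \<Rightarrow> (real^2) \<Rightarrow>\<^sub>L (real^2)" and \<gamma> v :: "real \<Rightarrow> real^2" and \<rho> :: "real \<Rightarrow> real"
  assumes D: "open D" "R \<subseteq> D" "range \<gamma> \<subseteq> D"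
    and R: "open R" "bounded R" "R \<noteq> {}" "frontier R \<subseteq> range \<gamma>"
    and T: "T > 0" "\<And>t. \<gamma> (t + T) = \<gamma> t"
    and v: "\<And>t. (\<gamma> has_vector_derivative v t) (at t)" "continuous_on UNIV v"
    and F': "\<And>x. x \<in> D \<Longrightarrow> (F has_derivative F' x) (at x)" "continuous_on D F'"
    and div: "\<And>x. x \<in> D \<Longrightarrow> (\<Sum>i\<in>UNIV. F' x (axis i 1) $ i) > 0"
    and \<rho>: "\<And>t. F (\<gamma> t) = \<rho> t *\<^sub>R v t" "continuous_on UNIV \<rho>"
  shows False
proof -
  have range_eq: "range \<gamma> = \<gamma> ` {0..T}"
    using periodic_range[of \<gamma> T, OF T(2,1)] image_mono[of "{0..<T}" "{0..T}" \<gamma>] by auto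
  have cont_\<gamma>: "continuous_on S \<gamma>" for S
    by (meson continuous_at_imp_continuous_on has_vector_derivative_continuous v(1))
  \<comment> \<open>All constants below are extrema over this compact subset of \<open>D\<close>,
    which contains both the region and the curve.\<close>
  define K where "K = closure R \<union> \<gamma> ` {0..T}"
  have "compact K"
    unfolding K_def using R(2) by (intro compact_Un compact_continuous_image cont_\<gamma>) auto
  then have K: "compact K" "R \<subseteq> K" "range \<gamma> \<subseteq> K" "K \<subseteq> D"
    using R(4) D closure_Un_frontier[of R] by (auto simp: K_def range_eq)
  have contF: "continuous_on D F"
    by (meson F'(1) continuous_at_imp_continuous_on has_derivative_continuous)

  obtain M where M: "M > 0" "\<And>x. x \<in> K \<Longrightarrow> norm (F x) \<le> M"
    using compact_imp_bounded[OF compact_continuous_image[OF continuous_on_subset[OF contF K(4)] K(1)]]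
    unfolding bounded_pos by auto
  obtain B where B: "B > 0" "\<And>t. t \<in> {0..T} \<Longrightarrow> \<bar>\<rho> t\<bar> \<le> B"
    using compact_imp_bounded[OF compact_continuous_image[OF continuous_on_subset[OF \<rho>(2)], of "{0..T}"]]
    unfolding bounded_pos by auto
  obtain W where W: "W > 0" "\<And>t. t \<in> {0..T} \<Longrightarrow> norm (v t) \<le> W"
    using compact_imp_bounded[OF compact_continuous_image[OF continuous_on_subset[OF v(2)], of "{0..T}"]]
    unfolding bounded_pos by auto
  have "W-lipschitz_on {0..T} \<gamma>"
  proof (rule bounded_derivative_imp_lipschitz)
    show "(\<gamma> has_derivative (\<lambda>h. h *\<^sub>R v t)) (at t within {0..T})" for t
      using v(1)[of t] unfolding has_vector_derivative_def by (rule has_derivative_at_withinI)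
    show "onorm (\<lambda>h. h *\<^sub>R v t) \<le> W" if "t \<in> {0..T}" for t
      using W(2)[OF that] by (intro onorm_le) (simp add: mult.commute[of W] mult_left_mono)
  qed (use W in auto)
  then obtain C where C: "C > 0"
    "\<And>r. \<lbrakk>0 < r; r \<le> 1\<rbrakk> \<Longrightarrow>
       \<exists>B\<in>lmeasurable. measure lebesgue B \<le> C * r \<and> (\<Union>t\<in>{0..T}. cball (\<gamma> t) r) \<subseteq> B"
    using lipschitz_curve_neighbourhood_measure[of W T \<gamma>] T(1) by (metis less_imp_le)
  obtain L where L: "L-lipschitz_on K F"
    using C1_lipschitz_on_compact[OF D(1) K(1,4) F'] by blast

  \<comment> \<open>\<open>A x\<close> is the Jacobian matrix of \<open>F\<close> and
    \<open>tr x\<close> the divergence. By compactness of \<open>K\<close> the latter has a positive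
    lower bound \<open>m\<close>, and the determinant is bounded by some \<open>Q\<close>.\<close>
  define A where "A x = matrix (F' x)" for x
  define tr where "tr x = (\<Sum>i\<in>UNIV. A x $ i $ i)" for x
  have A_nth: "A x $ i $ j = F' x (axis j 1) $ i" for x i j
    by (simp add: A_def matrix_def)
  have cont_A: "continuous_on K (\<lambda>x. A x $ i $ j)" for i j
    unfolding A_nth by (intro continuous_intros continuous_on_subset[OF F'(2) K(4)])
  have "continuous_on K tr" unfolding tr_def by (intro continuous_intros cont_A)
  moreover have "K \<noteq> {}" using R K by auto
  ultimately obtain x0 where "x0 \<in> K" "\<And>x. x \<in> K \<Longrightarrow> tr x0 \<le> tr x"
    using continuous_attains_inf[OF K(1)] by metis
  then obtain m where m: "m > 0" "\<And>x. x \<in> K \<Longrightarrow> m \<le> tr x"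
    using div[of x0] K(4) by (auto simp: tr_def A_nth)
  have "continuous_on K (\<lambda>x. det (A x))"
    unfolding det_2 by (intro continuous_intros cont_A)
  then have "bounded ((\<lambda>x. det (A x)) ` K)"
    using K(1) by (intro compact_imp_bounded compact_continuous_image)
  then obtain Q where Q: "Q > 0" "\<And>x. x \<in> K \<Longrightarrow> \<bar>det (A x)\<bar> \<le> Q"
    unfolding bounded_pos by auto
  define a where "a = measure lebesgue R"
  have R_meas: "R \<in> lmeasurable" using R by (intro lmeasurable_open)
  have a: "a > 0"
    using open_not_negligible[OF R(1,3)] R_meas
    by (metis a_def negligible_iff_measure measure_nonneg order_le_less)

  \<comment> \<open>Chosen so that \<open>r = h * \<epsilon> * (1 + B)\<close> satisfies
    \<open>C * r = a * h * m / 4\<close>, half of the area gained by the step.\<close>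
  define \<epsilon> where "\<epsilon> = m * a / (4 * C * (1 + B))"
  have \<epsilon>: "\<epsilon> > 0" using m a C B by (simp add: \<epsilon>_def)
  have "uniformly_continuous_on K F"
    using K contF by (intro compact_uniformly_continuous) (auto intro: continuous_on_subset)
  then obtain \<delta>1 where \<delta>1: "\<delta>1 > 0"
    "\<And>x y. \<lbrakk>x \<in> K; y \<in> K; dist x y < \<delta>1\<rbrakk> \<Longrightarrow> dist (F x) (F y) < \<epsilon>"
    using \<epsilon> unfolding uniformly_continuous_on_def by metis
  \<comment> \<open>The margin of 1 on either side leaves room for \<open>t + \<tau>\<close> with
    \<open>t\<close> in \<open>{0..T}\<close> and \<open>\<bar>\<tau>\<bar> \<le> 1\<close>.\<close>
  have "uniformly_continuous_on {-1..T+1} v"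
    by (intro compact_uniformly_continuous) (auto intro: continuous_on_subset[OF v(2)])
  then obtain \<delta>2 where \<delta>2: "\<delta>2 > 0"
    "\<And>s t. \<lbrakk>s \<in> {-1..T+1}; t \<in> {-1..T+1}; dist s t < \<delta>2\<rbrakk> \<Longrightarrow> dist (v s) (v t) < \<epsilon>"
    using \<epsilon> unfolding uniformly_continuous_on_def by metis
  have lin: "norm (\<gamma> (t + \<tau>) - \<gamma> t - \<tau> *\<^sub>R v t) \<le> \<bar>\<tau>\<bar> * \<epsilon>"
    if t: "t \<in> {0..T}" and \<tau>: "\<bar>\<tau>\<bar> < \<delta>2" "\<bar>\<tau>\<bar> \<le> 1" for t \<tau>
  proof -
    have "norm (\<gamma> (t + \<tau>) - \<gamma> t - ((t + \<tau>) - t) *\<^sub>R v t) \<le> norm ((t + \<tau>) - t) * \<epsilon>"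
    proof (rule vector_differentiable_bound_linearization)
      show "(\<gamma> has_vector_derivative v x) (at x within closed_segment t (t + \<tau>))" for x
        using v(1) by (rule has_vector_derivative_at_within)
      show "norm (v x - v t) \<le> \<epsilon>" if "x \<in> closed_segment t (t + \<tau>)" for x
      proof -
        have "\<bar>x - t\<bar> \<le> \<bar>\<tau>\<bar>"
          using that by (auto simp: closed_segment_eq_real_ivl split: if_splits)
        then have "dist (v x) (v t) < \<epsilon>"
          using t \<tau> by (intro \<delta>2(2)) (auto simp: dist_real_def)
        then show ?thesis by (simp add: dist_norm)
      qed
    qed auto
    then show ?thesis by simp
  qed

  have L0: "L \<ge> 0" using L by (rule lipschitz_on_nonneg)
  \<comment> \<open>In order, the bounds make the Euler step injective, keep \<open>F\<close> within
    \<open>\<epsilon>\<close> along the step, keep the parameter shift \<open>\<tau>\<close> below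
    \<open>\<delta>2\<close> and at most 1, make the quadratic term of the determinant at most
    \<open>h * m / 2\<close>, and give \<open>r \<le> 1\<close>.\<close>
  define h where "h = Min {1 / (L + 1), \<delta>1 / (2 * M), \<delta>2 / (2 * B), 1 / B, m / (2 * Q), 1 / (\<epsilon> * (1 + B))}"
  have h: "h > 0" and h_le: "h \<le> 1 / (L + 1)" "h \<le> \<delta>1 / (2 * M)" "h \<le> \<delta>2 / (2 * B)" "h \<le> 1 / B"
    "h \<le> m / (2 * Q)" "h \<le> 1 / (\<epsilon> * (1 + B))"
    using L0 \<delta>1 \<delta>2 M B m Q \<epsilon> by (auto simp: h_def)
  have h_le': "h * L < 1" "h * M < \<delta>1" "h * B < \<delta>2" "h * B \<le> 1" "h * Q \<le> m / 2" "h * \<epsilon> * (1 + B) \<le> 1"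
  proof -
    have "h * (L + 1) \<le> 1" using h_le(1) L0 by (simp add: field_simps)
    then show "h * L < 1" using h by (simp add: algebra_simps)
    show "h * M < \<delta>1" "h * B < \<delta>2" using h_le(2,3) M(1) B(1) \<delta>1(1) \<delta>2(1) by (simp_all add: field_simps)
    show "h * B \<le> 1" "h * Q \<le> m / 2" using h_le(4,5) B(1) Q(1) by (simp_all add: field_simps)
    show "h * \<epsilon> * (1 + B) \<le> 1" 
    proof -
      have "\<epsilon> * (1 + B) > 0" using B(1) \<epsilon> by simp
      then show ?thesis using h_le(6) by (simp only: pos_le_divide_eq mult.assoc)
    qed
  qed
  define \<Phi> where "\<Phi> x = x + h *\<^sub>R F x" for x
  define r where "r = h * \<epsilon> * (1 + B)"
  have r: "0 < r" "r \<le> 1" using h \<epsilon> B h_le'(6) by (auto simp: r_def)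

  text \<open>A point that the Euler step moves out of \<open>R\<close> first meets the curve at some \<open>p\<close>; the rest of the
    step follows \<open>F p\<close>, hence the curve, up to \<open>o(h)\<close>.\<close>
  have outside: "\<exists>t\<in>{0..T}. \<Phi> x \<in> cball (\<gamma> t) r" if x: "x \<in> R" "\<Phi> x \<notin> R" for x
  proof -
    have "closed_segment x (\<Phi> x) \<inter> frontier R \<noteq> {}"
      by (rule connected_Int_frontier) (use x in auto)
    then obtain w where w: "0 \<le> w" "w \<le> 1" "(1 - w) *\<^sub>R x + w *\<^sub>R \<Phi> x \<in> frontier R"
      by (auto simp: in_segment)
    define p where "p = x + (w * h) *\<^sub>R F x"
    have "p \<in> frontier R" using w(3) by (simp add: p_def \<Phi>_def algebra_simps)
    then obtain t where t: "t \<in> {0..T}" "p = \<gamma> t" using R(4) range_eq by blast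
    have xK: "x \<in> K" "p \<in> K" using x K t by auto
    have wh: "w * h \<le> h" using w h by (simp add: mult_left_le_one_le)
    have "dist x p = w * h * norm (F x)" using w h by (simp add: p_def dist_norm)
    also have "\<dots> \<le> h * M" using M(2)[OF xK(1)] w h wh by (intro mult_mono) auto
    finally have Fxp: "norm (F x - F p) \<le> \<epsilon>"
      using \<delta>1(2)[OF xK] h_le'(2) by (simp add: dist_norm)
    \<comment> \<open>The time left after reaching \<open>p\<close>. Since
      \<open>F p = \<rho> t *\<^sub>R v t\<close>, moving along \<open>F p\<close> for time
      \<open>s\<close> agrees to first order with moving the parameter of the curve by
      \<open>s * \<rho> t\<close>.\<close>
    define s where "s = (1 - w) * h"
    have s: "0 \<le> s" "s \<le> h" using w h by (auto simp: s_def mult_left_le_one_le)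
    define \<tau> where "\<tau> = s * \<rho> t"
    have \<tau>: "\<bar>\<tau>\<bar> \<le> h * B"
      unfolding \<tau>_def abs_mult using s h B(2)[OF t(1)] by (intro mult_mono) auto
    have *: "norm (\<gamma> (t + \<tau>) - \<gamma> t - \<tau> *\<^sub>R v t) \<le> h * B * \<epsilon>"
    proof -
      have "norm (\<gamma> (t + \<tau>) - \<gamma> t - \<tau> *\<^sub>R v t) \<le> \<bar>\<tau>\<bar> * \<epsilon>"
        using \<tau> h_le' by (intro lin t(1)) auto
      also have "\<dots> \<le> h * B * \<epsilon>" using \<tau> \<epsilon> by (intro mult_right_mono) auto
      finally show ?thesis .
    qed
    have \<Phi>x: "\<Phi> x = p + s *\<^sub>R F x" by (simp add: \<Phi>_def s_def p_def algebra_simps)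
    have \<tau>v: "\<tau> *\<^sub>R v t = s *\<^sub>R F p" by (simp add: \<tau>_def t(2) \<rho>(1))
    have "\<Phi> x - \<gamma> (t + \<tau>) = s *\<^sub>R (F x - F p) - (\<gamma> (t + \<tau>) - \<gamma> t - \<tau> *\<^sub>R v t)"
      by (simp add: \<Phi>x \<tau>v t(2)[symmetric] algebra_simps)
    then have "norm (\<Phi> x - \<gamma> (t + \<tau>)) \<le> norm (s *\<^sub>R (F x - F p)) + norm (\<gamma> (t + \<tau>) - \<gamma> t - \<tau> *\<^sub>R v t)"
      by (metis norm_triangle_ineq4)
    also have "\<dots> \<le> h * \<epsilon> + h * B * \<epsilon>"
      using s h Fxp * \<epsilon> by (intro add_mono) (auto intro!: mult_mono)
    also have "\<dots> = r" by (simp add: r_def algebra_simps)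
    finally have "\<Phi> x \<in> cball (\<gamma> (t + \<tau>)) r" by (simp add: dist_norm norm_minus_commute)
    moreover have "\<gamma> (t + \<tau>) \<in> \<gamma> ` {0..T}" using range_eq by blast
    ultimately show ?thesis by auto
  qed

  have der_\<Phi>: "(\<Phi> has_derivative (\<lambda>y. y + h *\<^sub>R F' x y)) (at x within R)" if "x \<in> R" for x
    unfolding \<Phi>_def using that D
    by (auto intro!: derivative_eq_intros has_derivative_at_withinI[OF F'(1)])
  have mat_\<Phi>: "matrix (\<lambda>y. y + h *\<^sub>R F' x y) = mat 1 + h *\<^sub>R A x" for x
    by (simp add: vec_eq_iff matrix_def A_def mat_def axis_def)
  have inj: "inj_on \<Phi> R"
  proof (rule inj_onI)
    fix x y assume xy: "x \<in> R" "y \<in> R" "\<Phi> x = \<Phi> y"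
    then have "x - y = h *\<^sub>R (F y - F x)" by (simp add: \<Phi>_def algebra_simps)
    then have "dist x y = h * dist (F y) (F x)" using h by (simp add: dist_norm)
    also have "\<dots> \<le> h * (L * dist y x)"
      using lipschitz_onD[OF L, of y x] xy K h by (intro mult_left_mono) auto
    finally have "(1 - h * L) * dist x y \<le> 0" by (simp add: algebra_simps dist_commute)
    then show "x = y" using h_le'(1) by (simp add: mult_le_0_iff)
  qed
  have cont_\<Phi>: "continuous_on R \<Phi>"
    by (rule has_derivative_continuous_on[OF der_\<Phi>])
  obtain N where N: "\<And>x. x \<in> R \<Longrightarrow> norm x \<le> N" using R(2) unfolding bounded_iff by blast
  have "bounded (\<Phi> ` R)"
    unfolding bounded_iff
  proof (intro exI ballI)
    fix y assume "y \<in> \<Phi> ` R"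
    then obtain x where x: "x \<in> R" "y = \<Phi> x" by blast
    have "norm y \<le> norm x + h * norm (F x)"
      unfolding x(2) \<Phi>_def using h norm_triangle_ineq[of x "h *\<^sub>R F x"] by simp
    also have "\<dots> \<le> N + h * M" using N x M K h by (intro add_mono mult_left_mono) auto
    finally show "norm y \<le> N + h * M" .
  qed
  \<comment> \<open>The image is open by invariance of domain, and bounded, hence of finite
    measure.\<close>
  then have \<Phi>R: "\<Phi> ` R \<in> lmeasurable"
    using invariance_of_domain[OF cont_\<Phi> R(1) inj] by (rule lmeasurable_open)
  have R_leb: "R \<in> sets lebesgue" using R_meas by (rule fmeasurableD)
  \<comment> \<open>The change of variables formula is used backwards here: finite area of the image
    yields integrability of the Jacobian determinant.\<close>
  have int: "(\<lambda>x. \<bar>det (mat 1 + h *\<^sub>R A x)\<bar>) integrable_on R"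
    using measurable_differentiable_image_eq[OF R_leb der_\<Phi> inj] \<Phi>R by (simp add: mat_\<Phi>)
  \<comment> \<open>Pointwise, the determinant is at least \<open>1 + h * m - h * m / 2\<close>,
    where the subtracted term absorbs the quadratic part.\<close>
  have "a * (1 + h * m / 2) = integral R (\<lambda>x. 1 + h * m / 2)"
    using integral_mult_right[of R "1 + h * m / 2" "\<lambda>x. 1"] R_meas
    by (simp add: a_def lmeasure_integral mult.commute)
  also have "\<dots> \<le> integral R (\<lambda>x. \<bar>det (mat 1 + h *\<^sub>R A x)\<bar>)"
  proof (rule integral_le[OF integrable_on_const[OF R_meas] int])
    fix x assume "x \<in> R"
    then have x: "x \<in> K" using K by auto
    have "h * \<bar>det (A x)\<bar> \<le> h * Q" using Q(2)[OF x] h by (intro mult_left_mono) auto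
    then have "h * \<bar>det (A x)\<bar> \<le> m / 2" using h_le'(5) by linarith
    then have "h * (h * \<bar>det (A x)\<bar>) \<le> h * (m / 2)" using h by (intro mult_left_mono) auto
    moreover have "h * (h * - det (A x)) \<le> h * (h * \<bar>det (A x)\<bar>)"
      using h by (intro mult_left_mono) auto
    ultimately have "- (h\<^sup>2 * det (A x)) \<le> h * m / 2" by (simp add: power2_eq_square mult.assoc)
    moreover have "h * m \<le> h * tr x" using m(2)[OF x] h by simp
    ultimately show "1 + h * m / 2 \<le> \<bar>det (mat 1 + h *\<^sub>R A x)\<bar>"
      unfolding det_one_plus_scaleR_2 tr_def by linarith
  qed
  also have "\<dots> = measure lebesgue (\<Phi> ` R)"
    using measure_differentiable_image_eq[OF R_leb der_\<Phi> inj] int by (simp add: mat_\<Phi>)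
  finally have lower: "a * (1 + h * m / 2) \<le> measure lebesgue (\<Phi> ` R)" .

  obtain N where N: "N \<in> lmeasurable" "measure lebesgue N \<le> C * r" "(\<Union>t\<in>{0..T}. cball (\<gamma> t) r) \<subseteq> N"
    using C(2)[OF r] by blast
  have "measure lebesgue (\<Phi> ` R) \<le> measure lebesgue (R \<union> N)"
  proof (rule measure_mono_fmeasurable)
    show "\<Phi> ` R \<subseteq> R \<union> N" using outside N(3) by blast
  qed (use N(1) R_meas \<Phi>R in \<open>auto intro: fmeasurableD\<close>)
  also have "\<dots> \<le> a + C * r"
    using measure_Un_le[of R lebesgue N] N(1,2) R_leb by (auto simp: a_def intro: fmeasurableD)
  also have "C * r = a * h * m / 4"
  proof -
    have "\<epsilon> * (4 * C * (1 + B)) = m * a" using C(1) B(1) by (simp add: \<epsilon>_def)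
    moreover have "4 * (C * r) = h * (\<epsilon> * (4 * C * (1 + B)))" by (simp add: r_def algebra_simps)
    ultimately show ?thesis by (simp add: mult_ac)
  qed
  finally have "a * h * m / 2 \<le> a * h * m / 4" using lower by (simp add: algebra_simps)
  moreover have "a * h * m > 0" using a h m by simp
  ultimately show False by linarith
qed

section \<open>Periodic orbits and the regions they enclose\<close>

text \<open>The set \<open>E\<close> where the solutions agree is closed, open and nonempty in the
  real line. For openness, on an interval of radius \<open>e\<close> around a point of
  \<open>E\<close> the largest distance \<open>X\<close> between them satisfies
  \<open>X \<le> e * L * X \<le> X / 2\<close>, so \<open>X = 0\<close>.\<close>

lemma autonomous_ode_unique:
  fixes \<gamma> \<eta> :: "real \<Rightarrow> 'a::real_normed_vector"
  assumes lip: "\<And>x. x \<in> D \<Longrightarrow> \<exists>r>0. \<exists>L. L-lipschitz_on (ball x r) u"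
    and \<gamma>: "\<And>t. (\<gamma> has_vector_derivative u (\<gamma> t)) (at t)" "range \<gamma> \<subseteq> D"
    and \<eta>: "\<And>t. (\<eta> has_vector_derivative u (\<eta> t)) (at t)"
    and init: "\<gamma> a = \<eta> a"
  shows "\<gamma> = \<eta>"
proof -
  have cont: "continuous_on S \<gamma>" "continuous_on S \<eta>" for S
    by (meson continuous_at_imp_continuous_on has_vector_derivative_continuous \<gamma>(1) \<eta>)+
  define E where "E = {t. \<gamma> t = \<eta> t}"
  have "closed E" unfolding E_def by (intro closed_Collect_eq cont)
  moreover have "open E"
    unfolding open_dist
  proof
    fix s assume s: "s \<in> E"
    obtain r L where r: "r > 0" and L: "L-lipschitz_on (ball (\<gamma> s) r) u"
      using lip[of "\<gamma> s"] \<gamma>(2) by blast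
    have L0: "L \<ge> 0" using L by (rule lipschitz_on_nonneg)
    have "isCont \<gamma> s" "isCont \<eta> s"
      using \<gamma>(1)[of s] \<eta>[of s] has_vector_derivative_continuous by blast+
    then obtain d1 d2 where d: "d1 > 0" "\<And>t. dist t s < d1 \<Longrightarrow> dist (\<gamma> t) (\<gamma> s) < r"
      "d2 > 0" "\<And>t. dist t s < d2 \<Longrightarrow> dist (\<eta> t) (\<eta> s) < r"
      using r unfolding continuous_at_eps_delta by metis
    \<comment> \<open>The first two entries keep both solutions in the ball where \<open>u\<close>
      is Lipschitz; the third gives the contraction factor 1/2.\<close>
    define e where "e = Min {d1 / 2, d2 / 2, 1 / (2 * (L + 1))}"
    have e: "e > 0" "e < d1" "e < d2" "e * L \<le> 1 / 2"
    proof -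
      show "e > 0" using d L0 by (auto simp: e_def)
      have "e \<le> d1 / 2" "e \<le> d2 / 2" "e \<le> 1 / (2 * (L + 1))" by (auto simp: e_def)
      then show "e < d1" "e < d2" using d by auto
      have "e * (L + 1) \<le> 1 / 2" using \<open>e \<le> 1 / (2 * (L + 1))\<close> L0 by (simp add: field_simps)
      then show "e * L \<le> 1 / 2" using \<open>e > 0\<close> by (simp add: algebra_simps)
    qed
    let ?I = "cball s e"
    have "\<exists>m\<in>?I. \<forall>t\<in>?I. norm (\<gamma> t - \<eta> t) \<le> norm (\<gamma> m - \<eta> m)"
      using e(1) by (intro continuous_attains_sup continuous_intros cont) auto
    then obtain m where m: "m \<in> ?I" "\<And>t. t \<in> ?I \<Longrightarrow> norm (\<gamma> t - \<eta> t) \<le> norm (\<gamma> m - \<eta> m)"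
      by blast
    define X where "X = norm (\<gamma> m - \<eta> m)"
    have bound: "norm (u (\<gamma> t) - u (\<eta> t)) \<le> L * X" if "t \<in> ?I" for t
    proof -
      have "\<gamma> t \<in> ball (\<gamma> s) r" "\<eta> t \<in> ball (\<gamma> s) r"
        using d(2,4)[of t] that e s by (auto simp: E_def dist_commute)
      then have "dist (u (\<gamma> t)) (u (\<eta> t)) \<le> L * dist (\<gamma> t) (\<eta> t)"
        by (rule lipschitz_onD[OF L])
      also have "\<dots> \<le> L * X"
        using m(2)[OF that] L0 unfolding X_def dist_norm by (rule mult_left_mono)
      finally show ?thesis by (simp add: dist_norm)
    qed
    have der: "((\<lambda>t. \<gamma> t - \<eta> t) has_derivative (\<lambda>h. h *\<^sub>R (u (\<gamma> t) - u (\<eta> t)))) (at t within ?I)" for t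
      using has_vector_derivative_diff[OF \<gamma>(1)[of t] \<eta>[of t]]
      unfolding has_vector_derivative_def by (rule has_derivative_at_withinI)
    have "norm ((\<gamma> m - \<eta> m) - (\<gamma> s - \<eta> s)) \<le> L * X * norm (m - s)"
    proof (rule differentiable_bound[OF _ der])
      show "onorm (\<lambda>h. h *\<^sub>R (u (\<gamma> t) - u (\<eta> t))) \<le> L * X" if "t \<in> ?I" for t
        using bound[OF that] by (intro onorm_le) (auto simp: mult.commute intro: mult_left_mono)
    qed (use m e in auto)
    also have "\<dots> \<le> L * X * e"
      using m(1) L0 by (intro mult_left_mono) (auto simp: X_def dist_norm norm_minus_commute)
    also have "\<dots> \<le> X / 2"
      using mult_right_mono[OF e(4), of X] by (simp add: X_def algebra_simps)
    finally have "X \<le> 0" using s by (simp add: E_def X_def)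
    then have "t \<in> E" if "t \<in> ?I" for t
      using m(2)[OF that] by (auto simp: E_def X_def)
    then show "\<exists>e>0. \<forall>t. dist t s < e \<longrightarrow> t \<in> E"
      using e(1) by (metis dist_commute less_imp_le mem_cball)
  qed
  ultimately have "E = UNIV" using init by (metis (mono_tags) E_def UNIV_I clopen empty_iff mem_Collect_eq)
  then show ?thesis by (auto simp: E_def)
qed

text \<open>The periods form a closed set. Arbitrarily small positive periods would force a
  continuous function to be constant, so the positive periods are bounded below by some
  \<open>\<delta>\<close>, and the least one is attained on a compact set.\<close>

lemma minimal_period:
  fixes \<gamma> :: "real \<Rightarrow> 'a::metric_space"
  assumes cont: "continuous_on UNIV \<gamma>" and T: "T > 0" "\<And>t. \<gamma> (t + T) = \<gamma> t"
    and nonconst: "\<not> \<gamma> constant_on UNIV"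
  obtains T0 where "T0 > 0" "\<And>t. \<gamma> (t + T0) = \<gamma> t"
    "\<And>p. \<lbrakk>0 < p; p < T0\<rbrakk> \<Longrightarrow> \<exists>t. \<gamma> (t + p) \<noteq> \<gamma> t"
proof -
  define P where "P = {p. \<forall>t. \<gamma> (t + p) = \<gamma> t}"
  have "closed P"
    unfolding P_def
    by (intro closed_Collect_all closed_Collect_eq continuous_intros continuous_on_compose2[OF cont]) auto
  have "\<exists>\<delta>>0. \<forall>p\<in>P. p > 0 \<longrightarrow> p \<ge> \<delta>"
  proof (rule ccontr)
    assume *: "\<not> ?thesis"
    have "\<gamma> s = \<gamma> 0" for s
    proof (rule ccontr)
      assume ne: "\<gamma> s \<noteq> \<gamma> 0"
      have "isCont \<gamma> 0" using cont by (simp add: continuous_on_eq_continuous_at)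
      then obtain d where d: "d > 0" "\<And>t. dist t 0 < d \<Longrightarrow> dist (\<gamma> t) (\<gamma> 0) < dist (\<gamma> s) (\<gamma> 0)"
        using ne unfolding continuous_at_eps_delta by (metis zero_less_dist_iff)
      obtain p where p: "p \<in> P" "0 < p" "p < d" using * d(1) by (meson not_le)
      have "\<gamma> s \<in> \<gamma> ` {0..<p}"
        using periodic_range[of \<gamma> p] p by (auto simp: P_def)
      then obtain r where "r \<in> {0..<p}" "\<gamma> s = \<gamma> r" by blast
      then show False using d(2)[of r] p by simp
    qed
    then show False using nonconst by (auto simp: constant_on_def)
  qed
  then obtain \<delta> where \<delta>: "\<delta> > 0" "\<And>p. \<lbrakk>p \<in> P; p > 0\<rbrakk> \<Longrightarrow> p \<ge> \<delta>" by blast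
  have "compact (P \<inter> {\<delta>..T})" using \<open>closed P\<close> by (simp add: closed_Int_compact)
  moreover have "T \<in> P \<inter> {\<delta>..T}" using T \<delta>(2)[of T] by (auto simp: P_def)
  ultimately have "\<exists>x\<in>P \<inter> {\<delta>..T}. \<forall>y\<in>P \<inter> {\<delta>..T}. x \<le> y"
    by (intro compact_attains_inf) (simp, metis empty_iff)
  then obtain T0 where T0: "T0 \<in> P \<inter> {\<delta>..T}" "\<And>p. p \<in> P \<inter> {\<delta>..T} \<Longrightarrow> T0 \<le> p"
    by metis
  show ?thesis
  proof
    show "T0 > 0" using T0 \<delta> by auto
    show "\<gamma> (t + T0) = \<gamma> t" for t using T0 by (auto simp: P_def)
    show "\<exists>t. \<gamma> (t + p) \<noteq> \<gamma> t" if "0 < p" "p < T0" for p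
    proof (rule ccontr)
      assume "\<not> ?thesis"
      then have "p \<in> P" by (simp add: P_def)
      then have "T0 \<le> p" using \<delta>(2)[of p] T0(1) that by (intro T0(2)) auto
      then show False using that by simp
    qed
  qed
qed

text \<open>If \<open>\<gamma> a = \<gamma> b\<close> with \<open>a < b\<close> within one minimal
  period, the two time shifts of the solution coincide by uniqueness, so \<open>b - a\<close> is a
  smaller period.\<close>

lemma periodic_solution_inj:
  fixes \<gamma> :: "real \<Rightarrow> 'a::real_normed_vector"
  assumes lip: "\<And>x. x \<in> D \<Longrightarrow> \<exists>r>0. \<exists>L. L-lipschitz_on (ball x r) u"
    and \<gamma>: "\<And>t. (\<gamma> has_vector_derivative u (\<gamma> t)) (at t)" "range \<gamma> \<subseteq> D"
    and T: "T > 0" "\<And>t. \<gamma> (t + T) = \<gamma> t" and nonconst: "\<not> \<gamma> constant_on UNIV"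
  obtains T0 where "T0 > 0" "\<And>t. \<gamma> (t + T0) = \<gamma> t" "inj_on \<gamma> {0..<T0}"
proof -
  have "continuous_on UNIV \<gamma>"
    by (meson continuous_at_imp_continuous_on has_vector_derivative_continuous \<gamma>(1))
  then obtain T0 where T0: "T0 > 0" "\<And>t. \<gamma> (t + T0) = \<gamma> t"
    "\<And>p. \<lbrakk>0 < p; p < T0\<rbrakk> \<Longrightarrow> \<exists>t. \<gamma> (t + p) \<noteq> \<gamma> t"
    using minimal_period[OF _ T nonconst] by blast
  have shift: "((\<lambda>t. \<gamma> (t + c)) has_vector_derivative u (\<gamma> (t + c))) (at t)" for c t
    using vector_diff_chain_at[of "\<lambda>t. t + c" 1 t \<gamma> "u (\<gamma> (t + c))"] \<gamma>(1)[of "t + c"]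
    by (simp add: o_def has_vector_derivative_add_const)
  have "inj_on \<gamma> {0..<T0}"
  proof (rule linorder_inj_onI)
    fix a b assume ab: "a < b" "a \<in> {0..<T0}" "b \<in> {0..<T0}"
    show "\<gamma> a \<noteq> \<gamma> b"
    proof
      assume "\<gamma> a = \<gamma> b"
      then have "(\<lambda>t. \<gamma> (t + a)) = (\<lambda>t. \<gamma> (t + b))"
        using \<gamma>(2) by (intro autonomous_ode_unique[where D = D and u = u and a = 0] lip shift) auto
      then have "\<gamma> (t + (b - a)) = \<gamma> t" for t
        by (metis add.commute add_diff_cancel_left' add_diff_eq diff_add_cancel)
      then show False using T0(3)[of "b - a"] ab by auto
    qed
  qed auto
  then show ?thesis using that T0(1,2) by blast
qed

section \<open>Transfer to the complex plane, where winding numbers and the Jordan curve theorem are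
  available\<close>

definition complex_of_vec :: "real^2 \<Rightarrow> complex" where
  "complex_of_vec x = Complex (x $ 1) (x $ 2)"

definition vec_of_complex :: "complex \<Rightarrow> real^2" where
  "vec_of_complex z = vector [Re z, Im z]"

lemma complex_vec_inverse [simp]:
  "complex_of_vec (vec_of_complex z) = z" "vec_of_complex (complex_of_vec x) = x"
  by (simp_all add: complex_of_vec_def vec_of_complex_def vec_eq_iff forall_2)

lemma continuous_on_complex_of_vec [continuous_intros]:
  "continuous_on S f \<Longrightarrow> continuous_on S (\<lambda>x. complex_of_vec (f x))"
  unfolding complex_of_vec_def Complex_eq by (intro continuous_intros)

lemma continuous_on_vec_of_complex [continuous_intros]:
  "continuous_on S f \<Longrightarrow> continuous_on S (\<lambda>x. vec_of_complex (f x))"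
proof -
  have "vec_of_complex z = (\<chi> i. if i = 1 then Re z else Im z)" for z
    by (simp add: vec_of_complex_def vec_eq_iff forall_2)
  moreover have "continuous_on S (\<lambda>x. if i = 1 then Re (f x) else Im (f x))"
    if "continuous_on S f" for i :: 2
    using that by (cases "i = 1") (auto intro!: continuous_intros)
  ultimately show "continuous_on S f \<Longrightarrow> continuous_on S (\<lambda>x. vec_of_complex (f x))"
    by (simp add: continuous_on_vec_lambda)
qed

lemma homeomorphism_complex_of_vec: "homeomorphism UNIV UNIV complex_of_vec vec_of_complex"
  by (auto simp: homeomorphism_def surj_def intro!: continuous_intros)
    (metis complex_vec_inverse)+

text \<open>The winding number around a point outside a simply connected set is 0 for loops in the
  set, whereas around an inside point of a simple loop it has modulus 1.\<close>

lemma inside_simple_loop_simply_connected: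
  fixes c :: "real \<Rightarrow> complex"
  assumes "simple_path c" "pathfinish c = pathstart c" "simply_connected S" "path_image c \<subseteq> S"
  shows "inside (path_image c) \<subseteq> S"
proof
  fix z assume z: "z \<in> inside (path_image c)"
  show "z \<in> S"
  proof (rule ccontr)
    assume "z \<notin> S"
    then have "winding_number c z = 0"
      using assms by (intro simply_connected_imp_winding_number_zero) (auto simp: simple_path_imp_path)
    then show False
      using simple_closed_path_norm_winding_number_inside[OF assms(1) z] by simp
  qed
qed

text \<open>\<open>R\<close> is the Jordan interior of the curve, computed in the complex plane and
  carried back by the homeomorphism.\<close>

lemma region_inside_closed_curve:
  fixes \<gamma> :: "real \<Rightarrow> real^2"
  assumes D: "simply_connected D" "range \<gamma> \<subseteq> D"
    and cont: "continuous_on UNIV \<gamma>"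
    and T: "T > 0" "\<And>t. \<gamma> (t + T) = \<gamma> t" and inj: "inj_on \<gamma> {0..<T}"
  obtains R where "open R" "bounded R" "R \<noteq> {}" "frontier R \<subseteq> range \<gamma>" "R \<subseteq> D"
proof -
  define c where "c s = complex_of_vec (\<gamma> (T * s))" for s
  have "path c"
    unfolding path_def c_def by (intro continuous_intros continuous_on_compose2[OF cont]) auto
  have "\<gamma> T = \<gamma> 0" using T(2)[of 0] by simp
  then have loop: "pathfinish c = pathstart c" by (simp add: pathfinish_def pathstart_def c_def)
  have "simple_path c"
    unfolding simple_path_def loop_free_def
  proof (intro conjI \<open>path c\<close> ballI impI)
    fix x y assume xy: "x \<in> {0..1::real}" "y \<in> {0..1}" "c x = c y"
    \<comment> \<open>Replacing the endpoint 1 by 0 moves both parameters into the half-open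
      interval where \<open>\<gamma>\<close> is injective.\<close>
    define n where "n x = (if x = 1 then 0 else x)" for x :: real
    have n: "T * n x \<in> {0..<T}" "\<gamma> (T * n x) = \<gamma> (T * x)" if "x \<in> {0..1}" for x
      using that T(1) \<open>\<gamma> T = \<gamma> 0\<close> by (auto simp: n_def)
    have "\<gamma> (T * x) = \<gamma> (T * y)" using xy(3) by (metis c_def complex_vec_inverse(2))
    then have "T * n x = T * n y" using n xy by (intro inj_onD[OF inj]) auto
    then show "x = y \<or> x = 0 \<and> y = 1 \<or> x = 1 \<and> y = 0"
      using T(1) by (auto simp: n_def split: if_splits)
  qed
  have img: "path_image c \<subseteq> complex_of_vec ` range \<gamma>" by (auto simp: path_image_def c_def)
  have sc: "simply_connected (complex_of_vec ` D)"
    using D(1) homeomorphic_simply_connected_eq[of D "complex_of_vec ` D"]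
      homeomorphism_of_subsets[OF homeomorphism_complex_of_vec, of D "complex_of_vec ` D"]
    by (auto simp: homeomorphic_def)
  define I where "I = inside (path_image c)"
  have I: "I \<noteq> {}" "open I" "bounded I" "frontier I = path_image c"
    using Jordan_inside_outside[OF \<open>simple_path c\<close> loop] by (auto simp: I_def)
  have ID: "I \<subseteq> complex_of_vec ` D"
    unfolding I_def using inside_simple_loop_simply_connected[OF \<open>simple_path c\<close> loop sc] img D(2) by blast
  show ?thesis
  proof
    show "open (vec_of_complex ` I)"
      using homeomorphism_imp_open_map[OF homeomorphism_symD[OF homeomorphism_complex_of_vec], of I] I(2)
      by simp
    have "compact (vec_of_complex ` closure I)"
      using I(3) by (intro compact_continuous_image continuous_intros) auto
    then show "bounded (vec_of_complex ` I)"
      by (meson bounded_subset closure_subset compact_imp_bounded image_mono)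
    show "vec_of_complex ` I \<noteq> {}" using I(1) by simp
    show "vec_of_complex ` I \<subseteq> D" using ID by force
    have "closure (vec_of_complex ` I) \<subseteq> vec_of_complex ` closure I"
      using \<open>compact (vec_of_complex ` closure I)\<close>
      by (intro closure_minimal image_mono closure_subset compact_imp_closed)
    moreover have "closure I = I \<union> path_image c" using I(4) closure_Un_frontier by metis
    ultimately have "frontier (vec_of_complex ` I) \<subseteq> vec_of_complex ` path_image c"
      using \<open>open (vec_of_complex ` I)\<close> by (auto simp: frontier_def interior_open)
    then show "frontier (vec_of_complex ` I) \<subseteq> range \<gamma>" using img by fastforce
  qed
qed

section \<open>Continuously differentiable fields and their divergence\<close>

abbreviation C1_on :: "('a::real_normed_vector \<Rightarrow> 'b::real_normed_vector) \<Rightarrow> 'a set \<Rightarrow> bool" where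
  "C1_on \<equiv> C_k_on (Suc 0)"

declare C_k_on.simps [simp del]

text \<open>By uniqueness of derivatives, any candidate \<open>f'\<close> may stand for
  \<open>frechet_derivative\<close>.\<close>

lemma C1_onI:
  assumes "\<And>x. x \<in> D \<Longrightarrow> (f has_derivative f' x) (at x)" "\<And>v. continuous_on D (\<lambda>x. f' x v)"
  shows "C1_on f D"
proof -
  have "f' x = frechet_derivative f (at x)" if "x \<in> D" for x
    using assms(1)[OF that] by (rule frechet_derivative_at)
  then have "continuous_on D (\<lambda>x. frechet_derivative f (at x) v)" for v
    using assms(2)[of v] by (simp cong: continuous_on_cong)
  then show ?thesis using assms(1) by (auto simp: C_k_on.simps differentiable_def)
qed

lemma C1_on_has_derivative:
  "C1_on f D \<Longrightarrow> x \<in> D \<Longrightarrow> (f has_derivative frechet_derivative f (at x)) (at x)"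
  by (simp add: C_k_on.simps frechet_derivative_works)

lemma C1_on_differentiable: "C1_on f D \<Longrightarrow> x \<in> D \<Longrightarrow> f differentiable (at x)"
  by (simp add: C_k_on.simps)

lemma C1_on_continuous_on: "C1_on f D \<Longrightarrow> continuous_on D f"
  by (simp add: C_k_on.simps continuous_at_imp_continuous_on differentiable_imp_continuous_within)

lemma C1_on_continuous_derivative:
  "C1_on f D \<Longrightarrow> continuous_on D (\<lambda>x. frechet_derivative f (at x) v)"
  by (simp add: C_k_on.simps)

text \<open>The derivatives are taken \<open>at x\<close> in the whole space, so equality on
  \<open>D\<close> transfers them because \<open>D\<close> is open.\<close>

lemma C1_on_cong:
  assumes "open D" "\<And>x. x \<in> D \<Longrightarrow> f x = g x"
  shows "C1_on f D \<longleftrightarrow> C1_on g D"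
proof -
  have "C1_on h D" if k: "C1_on k D" "\<And>x. x \<in> D \<Longrightarrow> k x = h x" for h k :: "'a \<Rightarrow> 'b"
  proof (rule C1_onI)
    show "(h has_derivative frechet_derivative k (at x)) (at x)" if "x \<in> D" for x
      using has_derivative_transform_within_open[OF C1_on_has_derivative[OF k(1) that] assms(1) that k(2)] .
    show "continuous_on D (\<lambda>x. frechet_derivative k (at x) v)" for v
      by (rule C1_on_continuous_derivative[OF k(1)])
  qed
  then show ?thesis using assms(2) by metis
qed

lemma C1_on_const: "C1_on (\<lambda>x. c) D"
  by (rule C1_onI) (auto intro!: derivative_eq_intros)

lemma C1_on_add: "C1_on f D \<Longrightarrow> C1_on g D \<Longrightarrow> C1_on (\<lambda>x. f x + g x) D"
  by (rule C1_onI[OF has_derivative_add[OF C1_on_has_derivative C1_on_has_derivative]])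
    (auto intro!: continuous_intros C1_on_continuous_derivative)

lemma C1_on_sum:
  "(\<And>i. i \<in> I \<Longrightarrow> C1_on (f i) D) \<Longrightarrow> C1_on (\<lambda>x. \<Sum>i\<in>I. f i x) D"
  by (induction I rule: infinite_finite_induct) (simp_all only: sum.infinite sum.empty sum.insert C1_on_const C1_on_add insert_iff simp_thms)

lemma C1_on_bounded_linear:
  assumes "bounded_linear L" "C1_on f D"
  shows "C1_on (\<lambda>x. L (f x)) D"
  by (rule C1_onI[OF bounded_linear.has_derivative[OF assms(1) C1_on_has_derivative[OF assms(2)]]])
    (auto intro!: bounded_linear.continuous_on[OF assms(1)] C1_on_continuous_derivative[OF assms(2)])

lemma C1_on_scaleR:
  assumes "C1_on f D" "C1_on g D"
  shows "C1_on (\<lambda>x. f x *\<^sub>R g x) D"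
  by (rule C1_onI[OF has_derivative_scaleR[OF C1_on_has_derivative[OF assms(1)] C1_on_has_derivative[OF assms(2)]]])
    (auto intro!: continuous_intros C1_on_continuous_derivative assms C1_on_continuous_on[OF assms(1)] C1_on_continuous_on[OF assms(2)])

lemma C1_on_mult:
  fixes f g :: "'a::real_normed_vector \<Rightarrow> real"
  shows "C1_on f D \<Longrightarrow> C1_on g D \<Longrightarrow> C1_on (\<lambda>x. f x * g x) D"
  using C1_on_scaleR[of f D g] by (simp only: real_scaleR_def)

lemma C1_on_minus: "C1_on f D \<Longrightarrow> C1_on (\<lambda>x. - f x) D"
  by (rule C1_on_bounded_linear[OF bounded_linear_minus[OF bounded_linear_ident]])

lemma C1_on_diff: "C1_on f D \<Longrightarrow> C1_on g D \<Longrightarrow> C1_on (\<lambda>x. f x - g x) D"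
  using C1_on_add[OF _ C1_on_minus, of f D g] by (simp only: diff_conv_add_uminus)

lemma C1_on_compose_real:
  fixes f :: "'a::real_normed_vector \<Rightarrow> real"
  assumes f: "C1_on f D"
    and \<phi>: "\<And>x. x \<in> D \<Longrightarrow> (\<phi> has_real_derivative \<phi>' (f x)) (at (f x))"
    and \<phi>': "continuous_on (f ` D) \<phi>'"
  shows "C1_on (\<lambda>x. \<phi> (f x)) D"
proof (rule C1_onI)
  show "((\<lambda>x. \<phi> (f x)) has_derivative (\<lambda>v. \<phi>' (f x) * frechet_derivative f (at x) v)) (at x)" if "x \<in> D" for x
    using diff_chain_at[OF C1_on_has_derivative[OF f that] has_field_derivative_imp_has_derivative[OF \<phi>[OF that]]]
    by (simp add: o_def)
  show "continuous_on D (\<lambda>x. \<phi>' (f x) * frechet_derivative f (at x) v)" for v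
    by (intro continuous_intros continuous_on_compose2[OF \<phi>'] C1_on_continuous_on[OF f]
        C1_on_continuous_derivative[OF f]) auto
qed

lemma C1_on_inverse:
  fixes f :: "'a::real_normed_vector \<Rightarrow> real"
  assumes "C1_on f D" "\<And>x. x \<in> D \<Longrightarrow> f x \<noteq> 0"
  shows "C1_on (\<lambda>x. inverse (f x)) D"
proof (rule C1_on_compose_real[OF assms(1), where \<phi>' = "\<lambda>y. - (inverse y ^ Suc (Suc 0))"])
  show "continuous_on (f ` D) (\<lambda>y. - (inverse y ^ Suc (Suc 0)))"
    using assms(2) by (intro continuous_intros) auto
qed (rule DERIV_inverse[OF assms(2)])

text \<open>Away from 0 the absolute value is locally the identity or its negative, with derivative
  \<open>sgn\<close>. It enters through the density \<open>sqrt (det g)\<close>, which equals the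
  absolute value of \<open>det J\<close>.\<close>

lemma C1_on_abs:
  fixes f :: "'a::real_normed_vector \<Rightarrow> real"
  assumes "C1_on f D" "\<And>x. x \<in> D \<Longrightarrow> f x \<noteq> 0"
  shows "C1_on (\<lambda>x. \<bar>f x\<bar>) D"
proof (rule C1_on_compose_real[OF assms(1), where \<phi>' = sgn])
  show "(abs has_real_derivative sgn (f x)) (at (f x))" if "x \<in> D" for x
  proof (cases "f x > 0")
    case True
    have "((\<lambda>y. y) has_real_derivative sgn (f x)) (at (f x))"
      using True by simp
    then show ?thesis
      by (rule has_field_derivative_transform_within_open[where S = "{0<..}"]) (use True in auto)
  next
    case False
    then have neg: "f x < 0" using assms(2)[OF that] by simp
    then have "((\<lambda>y. - y) has_real_derivative sgn (f x)) (at (f x))"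
      using DERIV_minus[OF DERIV_ident, of "f x" UNIV] by simp
    then show ?thesis
      by (rule has_field_derivative_transform_within_open[where S = "{..<0}"]) (use neg in auto)
  qed
  show "continuous_on (f ` D) sgn"
    using assms(2) by (intro continuous_on_sgn continuous_intros) auto
qed

lemma C1_on_vec_nth: "C1_on f D \<Longrightarrow> C1_on (\<lambda>x. f x $ i) D"
  by (rule C1_on_bounded_linear[OF bounded_linear_vec_nth])

lemma C1_on_vec_lambda:
  fixes f :: "'a::real_normed_vector \<Rightarrow> real^'n"
  assumes "\<And>i. C1_on (\<lambda>x. f x $ i) D"
  shows "C1_on f D"
proof -
  have "C1_on (\<lambda>x. \<Sum>i\<in>UNIV. (f x $ i) *\<^sub>R (axis i 1 :: real^'n)) D"
    by (intro C1_on_sum C1_on_scaleR assms C1_on_const)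
  then show ?thesis using basis_expansion[of "f _"] by (simp only: scalar_mult_eq_scaleR)
qed

text \<open>\<open>C_k_on\<close> asks for continuity of the derivative in each direction
  separately. In finite dimension this amounts to continuity as a map into bounded linear operators,
  the form that the area argument works with.\<close>

lemma C1_on_blinfun_derivative:
  fixes F :: "real^'n \<Rightarrow> real^'n"
  assumes "C1_on F D"
  obtains F' where "\<And>x. x \<in> D \<Longrightarrow> (F has_derivative blinfun_apply (F' x)) (at x)" "continuous_on D F'"
    "\<And>x. x \<in> D \<Longrightarrow> (\<Sum>i\<in>UNIV. F' x (axis i 1) $ i) = divergence F x"
proof
  define F' where "F' x = Blinfun (frechet_derivative F (at x))" for x
  have F': "blinfun_apply (F' x) = frechet_derivative F (at x)" if "x \<in> D" for x
    unfolding F'_def using C1_on_has_derivative[OF assms that]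
    by (intro bounded_linear_Blinfun_apply has_derivative_bounded_linear)
  show "(F has_derivative blinfun_apply (F' x)) (at x)" if "x \<in> D" for x
    using C1_on_has_derivative[OF assms that] F'[OF that] by simp
  show "continuous_on D F'"
    using C1_on_continuous_derivative[OF assms]
    by (intro continuous_on_blinfun_componentwise) (simp add: F' cong: continuous_on_cong)
  show "(\<Sum>i\<in>UNIV. F' x (axis i 1) $ i) = divergence F x" if "x \<in> D" for x
  proof -
    have "(\<lambda>v. frechet_derivative F (at x) v $ i) = frechet_derivative (\<lambda>y. F y $ i) (at x)" for i
      by (intro frechet_derivative_at bounded_linear.has_derivative[OF bounded_linear_vec_nth]
          C1_on_has_derivative[OF assms that])
    then show ?thesis by (simp add: divergence_def partial_deriv_def F'[OF that] fun_eq_iff)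
  qed
qed

section \<open>Rules for the divergence and the gradient\<close>

lemma divergence_eqI:
  assumes "(F has_derivative F') (at x)"
  shows "divergence F x = (\<Sum>i\<in>UNIV. F' (axis i 1) $ i)"
proof -
  have "frechet_derivative (\<lambda>y. F y $ i) (at x) = (\<lambda>v. F' v $ i)" for i
    by (rule frechet_derivative_at[symmetric])
      (rule bounded_linear.has_derivative[OF bounded_linear_vec_nth assms])
  then show ?thesis by (simp add: divergence_def partial_deriv_def)
qed

lemma divergence_cong:
  assumes "open D" "x \<in> D" "\<And>y. y \<in> D \<Longrightarrow> F y = G y"
    and "F differentiable (at x)"
  shows "divergence F x = divergence G x"
proof -
  obtain F' where F': "(F has_derivative F') (at x)" using assms(4) by (auto simp: differentiable_def)
  have "(G has_derivative F') (at x)"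
    using has_derivative_transform_within_open[OF F' assms(1,2)] assms(3) by blast
  then show ?thesis using F' by (simp add: divergence_eqI)
qed

lemma divergence_diff:
  assumes "F differentiable (at x)" "G differentiable (at x)"
  shows "divergence (\<lambda>y. F y - G y) x = divergence F x - divergence G x"
proof -
  obtain F' G' where "(F has_derivative F') (at x)" "(G has_derivative G') (at x)"
    using assms by (auto simp: differentiable_def)
  then show ?thesis
    by (simp add: divergence_eqI divergence_eqI[OF has_derivative_diff] sum_subtractf)
qed

lemma divergence_scaleR:
  assumes "F differentiable (at x)"
  shows "divergence (\<lambda>y. c *\<^sub>R F y) x = c * divergence F x"
proof -
  obtain F' where "(F has_derivative F') (at x)"
    using assms by (auto simp: differentiable_def)
  then show ?thesis
    by (simp add: divergence_eqI divergence_eqI[OF has_derivative_scaleR_right] sum_distrib_left)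
qed

lemma grad_minus:
  assumes "V differentiable (at y)"
  shows "grad (\<lambda>x. - V x) y = - grad V y"
proof -
  have "frechet_derivative (\<lambda>x. - V x) (at y) = (\<lambda>h. - frechet_derivative V (at y) h)"
    using assms by (intro frechet_derivative_at[symmetric] has_derivative_minus) (simp add: frechet_derivative_works)
  then show ?thesis by (simp add: grad_def partial_deriv_def vec_eq_iff)
qed

text \<open>The mean value theorem is applied twice: along \<open>a\<close> to the difference of
  \<open>H\<close> on two parallel sides of the parallelogram, then along \<open>b\<close> to the
  derivative of \<open>H\<close> in direction \<open>a\<close>.\<close>

lemma C_2_second_difference:
  fixes H :: "'a::real_normed_vector \<Rightarrow> real"
  assumes H: "\<And>y. y \<in> D \<Longrightarrow> H differentiable (at y)"
    and Ha: "\<And>y. y \<in> D \<Longrightarrow> (\<lambda>z. frechet_derivative H (at z) a) differentiable (at y)"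
    and h: "h > 0" and D: "\<And>s t. \<lbrakk>0 \<le> s; s \<le> h; 0 \<le> t; t \<le> h\<rbrakk> \<Longrightarrow> x + s *\<^sub>R a + t *\<^sub>R b \<in> D"
  obtains s t where "0 \<le> s" "s \<le> h" "0 \<le> t" "t \<le> h"
    "H (x + h *\<^sub>R a + h *\<^sub>R b) - H (x + h *\<^sub>R a) - H (x + h *\<^sub>R b) + H x =
      h * h * frechet_derivative (\<lambda>z. frechet_derivative H (at z) a) (at (x + s *\<^sub>R a + t *\<^sub>R b)) b"
proof -
  let ?Ha = "\<lambda>z. frechet_derivative H (at z) a"
  have line: "((\<lambda>s. K (p + s *\<^sub>R w)) has_real_derivative frechet_derivative K (at (p + s *\<^sub>R w)) w) (at s)"
    if "K differentiable (at (p + s *\<^sub>R w))" for K :: "'a \<Rightarrow> real" and p w s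
  proof -
    have "((\<lambda>s. p + s *\<^sub>R w) has_derivative (\<lambda>r. r *\<^sub>R w)) (at s)"
      by (auto intro!: derivative_eq_intros)
    from diff_chain_at[OF this, of K] that
    have "((\<lambda>s. K (p + s *\<^sub>R w)) has_derivative (\<lambda>r. frechet_derivative K (at (p + s *\<^sub>R w)) (r *\<^sub>R w))) (at s)"
      by (simp add: o_def frechet_derivative_works)
    moreover have "frechet_derivative K (at (p + s *\<^sub>R w)) (r *\<^sub>R w) = frechet_derivative K (at (p + s *\<^sub>R w)) w * r" for r
      using linear_frechet_derivative[OF that] by (simp add: linear_scale)
    ultimately show ?thesis by (simp add: has_field_derivative_def)
  qed
  let ?\<phi> = "\<lambda>s. H ((x + h *\<^sub>R b) + s *\<^sub>R a) - H (x + s *\<^sub>R a)"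
  have "(?\<phi> has_real_derivative (?Ha ((x + h *\<^sub>R b) + s *\<^sub>R a) - ?Ha (x + s *\<^sub>R a))) (at s)"
    if "0 \<le> s" "s \<le> h" for s
    using D[OF that, of h] D[OF that, of 0] h
    by (intro DERIV_diff line H) (auto simp: add_ac)
  from MVT2[OF h this] obtain s where s: "0 < s" "s < h"
    "?\<phi> h - ?\<phi> 0 = h * (?Ha ((x + h *\<^sub>R b) + s *\<^sub>R a) - ?Ha (x + s *\<^sub>R a))"
    by auto
  have "((\<lambda>t. ?Ha ((x + s *\<^sub>R a) + t *\<^sub>R b)) has_real_derivative
      frechet_derivative ?Ha (at ((x + s *\<^sub>R a) + t *\<^sub>R b)) b) (at t)" if "0 \<le> t" "t \<le> h" for t
    using D[of s t] s that by (intro line Ha) auto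
  from MVT2[OF h this] obtain t where t: "0 < t" "t < h"
    "?Ha ((x + s *\<^sub>R a) + h *\<^sub>R b) - ?Ha ((x + s *\<^sub>R a) + 0 *\<^sub>R b) =
      h * frechet_derivative ?Ha (at ((x + s *\<^sub>R a) + t *\<^sub>R b)) b"
    by auto
  show ?thesis
    using s t by (intro that[of s t]) (auto simp: add_ac)
qed

text \<open>The second difference of \<open>H\<close> over a parallelogram is symmetric in
  \<open>a\<close> and \<open>b\<close>, so the two mixed derivatives take a common value at points
  arbitrarily close to \<open>x\<close>; continuity then makes them equal at
  \<open>x\<close>.\<close>

lemma C_2_symmetric_derivative:
  fixes H :: "'a::real_normed_vector \<Rightarrow> real"
  assumes D: "open D" "x \<in> D" and H: "C_k_on 2 H D"
  shows "frechet_derivative (\<lambda>y. frechet_derivative H (at y) a) (at x) b =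
    frechet_derivative (\<lambda>y. frechet_derivative H (at y) b) (at x) a"
proof -
  define S where "S = (\<lambda>a b y. frechet_derivative (\<lambda>y. frechet_derivative H (at y) a) (at y) b)"
  have H1: "H differentiable (at y)" if "y \<in> D" for y
    using H that by (simp add: C_k_on.simps numeral_2_eq_2)
  have H2: "(\<lambda>y. frechet_derivative H (at y) a) differentiable (at y)" if "y \<in> D" for y a
    using H that by (simp add: C_k_on.simps numeral_2_eq_2)
  have cont: "isCont (S a b) x" for a b
    using H D by (simp add: C_k_on.simps numeral_2_eq_2 S_def continuous_on_eq_continuous_at)
  have "\<bar>S a b x - S b a x\<bar> \<le> e" if e: "e > 0" for e
  proof -
    obtain d1 where d1: "d1 > 0" "ball x d1 \<subseteq> D" using D open_contains_ball by blast
    obtain d2 where d2: "d2 > 0" "\<And>y. dist y x < d2 \<Longrightarrow> dist (S a b y) (S a b x) < e / 2"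
      using cont[of a b, unfolded continuous_at_eps_delta, rule_format, OF half_gt_zero[OF e]] by blast
    obtain d3 where d3: "d3 > 0" "\<And>y. dist y x < d3 \<Longrightarrow> dist (S b a y) (S b a x) < e / 2"
      using cont[of b a, unfolded continuous_at_eps_delta, rule_format, OF half_gt_zero[OF e]] by blast
    define d where "d = Min {d1, d2, d3}"
    have d: "d > 0" "d \<le> d1" "d \<le> d2" "d \<le> d3" using d1 d2 d3 by (auto simp: d_def)
    \<comment> \<open>The added 1 avoids division by zero for \<open>a = b = 0\<close>; the
      parallelogram with sides \<open>h *\<^sub>R a\<close> and \<open>h *\<^sub>R b\<close> stays
      within distance \<open>d\<close> of \<open>x\<close>.\<close>
    define K where "K = norm a + norm b + 1"
    define h where "h = d / (2 * K)"
    have pos: "K > 0" by (simp add: K_def add_nonneg_pos)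
    have h: "h > 0" using d pos by (simp add: h_def)
    have "h * K = d / 2" using pos by (simp add: h_def)
    then have hd: "h * norm a + h * norm b < d" using h d by (simp add: K_def algebra_simps)
    have near: "dist (x + s *\<^sub>R a + t *\<^sub>R b) x < d" if "0 \<le> s" "s \<le> h" "0 \<le> t" "t \<le> h" for s t
    proof -
      have "dist (x + s *\<^sub>R a + t *\<^sub>R b) x \<le> norm (s *\<^sub>R a) + norm (t *\<^sub>R b)"
        using norm_triangle_ineq[of "s *\<^sub>R a" "t *\<^sub>R b"] by (simp add: dist_norm)
      also have "\<dots> \<le> h * norm a + h * norm b"
        using that by (auto intro!: add_mono mult_right_mono)
      finally show ?thesis using hd by simp
    qed
    have inD: "x + s *\<^sub>R a + t *\<^sub>R b \<in> D" if "0 \<le> s" "s \<le> h" "0 \<le> t" "t \<le> h" for s t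
      using near[OF that] d1(2) d(2) by (auto simp: dist_commute subset_iff)
    obtain s1 t1 where 1: "0 \<le> s1" "s1 \<le> h" "0 \<le> t1" "t1 \<le> h"
      "H (x + h *\<^sub>R a + h *\<^sub>R b) - H (x + h *\<^sub>R a) - H (x + h *\<^sub>R b) + H x = h * h * S a b (x + s1 *\<^sub>R a + t1 *\<^sub>R b)"
      unfolding S_def using C_2_second_difference[OF H1 H2 h inD] by blast
    have inD': "x + s *\<^sub>R b + t *\<^sub>R a \<in> D" if "0 \<le> s" "s \<le> h" "0 \<le> t" "t \<le> h" for s t
      using inD[OF that(3,4,1,2)] by (simp add: add_ac)
    obtain s2 t2 where 2: "0 \<le> s2" "s2 \<le> h" "0 \<le> t2" "t2 \<le> h"
      "H (x + h *\<^sub>R b + h *\<^sub>R a) - H (x + h *\<^sub>R b) - H (x + h *\<^sub>R a) + H x = h * h * S b a (x + s2 *\<^sub>R b + t2 *\<^sub>R a)"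
      unfolding S_def using C_2_second_difference[OF H1 H2 h inD'] by blast
    have "h * h * S a b (x + s1 *\<^sub>R a + t1 *\<^sub>R b) = h * h * S b a (x + s2 *\<^sub>R b + t2 *\<^sub>R a)"
      using 1(5) 2(5) unfolding add.commute[of "h *\<^sub>R b" "h *\<^sub>R a"] add.assoc by linarith
    then have "S a b (x + s1 *\<^sub>R a + t1 *\<^sub>R b) = S b a (x + s2 *\<^sub>R b + t2 *\<^sub>R a)" using h by simp
    moreover have "dist (S a b (x + s1 *\<^sub>R a + t1 *\<^sub>R b)) (S a b x) < e / 2"
      using near[OF 1(1-4)] d(3) by (intro d2(2)) simp
    moreover have "dist (S b a (x + s2 *\<^sub>R b + t2 *\<^sub>R a)) (S b a x) < e / 2"
      using near[OF 2(3,4,1,2)] d(4) by (intro d3(2)) (simp add: add_ac)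
    ultimately show ?thesis unfolding dist_real_def by linarith
  qed
  then have "\<bar>S a b x - S b a x\<bar> \<le> 0" by (metis field_le_epsilon add_0)
  then show ?thesis by (simp add: S_def)
qed

text \<open>The adjugate formula, which makes the entries of the inverse metric visibly
  differentiable.\<close>

lemma matrix_inv_2:
  fixes A :: "real^2^2"
  assumes "det A \<noteq> 0"
  shows "matrix_inv A = (1 / det A) *\<^sub>R vector [vector [A $ 2 $ 2, - A $ 1 $ 2], vector [- A $ 2 $ 1, A $ 1 $ 1]]"
    (is "_ = ?B")
proof -
  have "A ** (c *\<^sub>R B) = c *\<^sub>R (A ** B)" for c :: real and B :: "real^2^2"
    by (simp add: vec_eq_iff matrix_matrix_mult_def sum_distrib_left mult_ac)
  moreover have "A ** vector [vector [A $ 2 $ 2, - A $ 1 $ 2], vector [- A $ 2 $ 1, A $ 1 $ 1]] = det A *\<^sub>R mat 1"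
    by (simp add: vec_eq_iff forall_2 matrix_matrix_mult_def sum_2 mat_def det_2 algebra_simps)
  ultimately have right: "A ** ?B = mat 1" using assms by simp
  \<comment> \<open>\<open>matrix_inv\<close> is defined by choice, so its inverse property is drawn
    from the existence of some inverse.\<close>
  have left: "matrix_inv A ** A = mat 1"
    using assms someI_ex[of "\<lambda>A'. A ** A' = mat 1 \<and> A' ** A = mat 1"]
    unfolding matrix_inv_def invertible_det_nz[symmetric] invertible_def by blast
  have "matrix_inv A = matrix_inv A ** (A ** ?B)" by (simp only: right matrix_mul_rid)
  also have "\<dots> = (matrix_inv A ** A) ** ?B" by (rule matrix_mul_assoc)
  also have "\<dots> = ?B" by (simp only: left matrix_mul_lid)
  finally show ?thesis .
qed

section \<open>Absence of closed orbits\<close>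

theorem theorem1:
  fixes D :: "(real^2) set"
    and f :: "real^2 \<Rightarrow> real^2"
    and g :: "real^2 \<Rightarrow> real^2^2"
    and V H :: "real^2 \<Rightarrow> real"
    and u :: "real^2 \<Rightarrow> real^2"
  assumes "open D" and "simply_connected D"
    and "smooth_on f D"
    and "\<And>x. x \<in> D \<Longrightarrow> invertible (jacobian f (at x))"
    and "\<And>x. x \<in> D \<Longrightarrow> g x = transpose (jacobian f (at x)) ** jacobian f (at x)"
    and "smooth_on V D" and "smooth_on H D"
    and "\<And>x. x \<in> D \<Longrightarrow>
           u x = - (matrix_inv (g x) *v grad V x)
                 + (sgn (det (jacobian f (at x))) / sqrt (det (g x))) *\<^sub>R (S_mat *v grad H x)"
    and "strictly_subharmonic_on D g V \<or> strictly_subharmonic_on D g (\<lambda>x. - V x)"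
  shows "\<not> (\<exists>C. closed_orbit u C \<and> C \<subseteq> D)"
proof
  assume "\<exists>C. closed_orbit u C \<and> C \<subseteq> D"
  then obtain \<gamma> T where \<gamma>: "\<And>t. (\<gamma> has_vector_derivative u (\<gamma> t)) (at t)" "range \<gamma> \<subseteq> D"
    and T: "T > 0" "\<And>t. \<gamma> (t + T) = \<gamma> t" and nonconst: "\<not> \<gamma> constant_on UNIV"
    unfolding closed_orbit_def by blast
  have deriv_C1: "C1_on (\<lambda>x. frechet_derivative k (at x) w) D" if "smooth_on k D"
    for k :: "real^2 \<Rightarrow> 'b::real_normed_vector" and w
    using that[unfolded smooth_on_def, THEN spec, of 2] by (simp add: C_k_on.simps numeral_2_eq_2)
  have C1_partial: "C1_on (partial_deriv i k) D" if "smooth_on k D" for k :: "real^2 \<Rightarrow> real" and i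
    using deriv_C1[OF that] by (simp add: partial_deriv_def[abs_def])

  define J where "J x = jacobian f (at x)" for x
  define d where "d x = det (J x)" for x
  have d: "d x \<noteq> 0" if "x \<in> D" for x
    using assms(4)[OF that] by (simp add: d_def J_def invertible_det_nz)
  have C1_J: "C1_on (\<lambda>x. J x $ i $ j) D" for i j
    using C1_on_vec_nth[OF deriv_C1[OF assms(3)]] by (simp add: J_def jacobian_def matrix_def)
  have C1_d: "C1_on d D"
    unfolding d_def[abs_def] det_2 by (intro C1_on_diff C1_on_mult C1_J)
  have C1_abs_d: "C1_on (\<lambda>x. \<bar>d x\<bar>) D" by (rule C1_on_abs[OF C1_d d])
  have det_g: "det (g x) = d x * d x" if "x \<in> D" for x
    using assms(5)[OF that] by (simp add: d_def J_def det_mul)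
  \<comment> \<open>Thus the density \<open>\<rho>\<close> is the absolute value of
    \<open>d\<close>, nonzero and continuously differentiable on \<open>D\<close>.\<close>
  have sqrt_det_g: "sqrt (det (g x)) = \<bar>d x\<bar>" if "x \<in> D" for x
    using det_g[OF that] by simp
  have C1_g: "C1_on (\<lambda>x. g x $ i $ j) D" for i j
  proof -
    have "C1_on (\<lambda>x. \<Sum>k\<in>UNIV. J x $ k $ i * J x $ k $ j) D"
      by (intro C1_on_sum C1_on_mult C1_J)
    then show ?thesis
      by (rule C1_on_cong[THEN iffD1, rotated 2])
        (auto simp: assms(1,5) J_def matrix_matrix_mult_def transpose_def)
  qed

  \<comment> \<open>The field splits as \<open>\<bar>d y\<bar> *\<^sub>R u y = - W y + sgn (d y)
    *\<^sub>R N y\<close> on \<open>D\<close>. The divergence of \<open>W\<close> is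
    \<open>\<bar>d\<bar>\<close> times the Laplace--Beltrami operator of \<open>V\<close>.\<close>
  define W where "W y = sqrt (det (g y)) *\<^sub>R (matrix_inv (g y) *v grad V y)" for y
  define N where "N y = S_mat *v grad H y" for y
  have C1_W: "C1_on W D"
  proof -
    \<comment> \<open>The adjugate of \<open>g x\<close>, so that the inverse metric is
      \<open>B x\<close> divided by \<open>d x * d x\<close>.\<close>
    define B where "B x = (vector [vector [g x $ 2 $ 2, - g x $ 1 $ 2], vector [- g x $ 2 $ 1, g x $ 1 $ 1]] :: real^2^2)" for x
    have C1_B: "C1_on (\<lambda>x. B x $ i $ j) D" for i j
      using exhaust_2[of i] exhaust_2[of j] by (auto simp: B_def intro!: C1_g C1_on_minus)
    have "C1_on (\<lambda>x. (B x *v grad V x) $ i) D" for i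
      unfolding matrix_vector_mult_def grad_def vec_lambda_beta
      by (intro C1_on_sum C1_on_mult C1_B C1_partial assms(6))
    then have "C1_on (\<lambda>x. B x *v grad V x) D" by (rule C1_on_vec_lambda)
    then have "C1_on (\<lambda>x. (\<bar>d x\<bar> * inverse (d x * d x)) *\<^sub>R (B x *v grad V x)) D"
      using d by (intro C1_on_scaleR C1_on_mult C1_abs_d C1_on_inverse C1_d) auto
    then show ?thesis
    proof (rule C1_on_cong[THEN iffD1, rotated 2])
      show "(\<bar>d x\<bar> * inverse (d x * d x)) *\<^sub>R (B x *v grad V x) = W x" if "x \<in> D" for x
        using d[OF that]
        by (simp add: W_def B_def matrix_inv_2 det_g[OF that] scaleR_matrix_vector_assoc[symmetric] divide_inverse)
    qed (rule assms(1))
  qed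
  have N_nth: "N y $ 1 = partial_deriv 2 H y" "N y $ 2 = - partial_deriv 1 H y" for y
    by (simp_all add: N_def S_mat_def grad_def matrix_vector_mult_def sum_2)
  have C1_N: "C1_on N D"
  proof (rule C1_on_vec_lambda)
    show "C1_on (\<lambda>x. N x $ i) D" for i
      using exhaust_2[of i] by (auto simp: N_nth intro!: C1_on_minus C1_partial assms(7))
  qed
  \<comment> \<open>The two terms of the divergence are the mixed second derivatives of
    \<open>H\<close> with opposite signs.\<close>
  have div_N: "divergence N x = 0" if x: "x \<in> D" for x
  proof -
    have "C_k_on 2 H D" using assms(7) by (simp add: smooth_on_def)
    from C_2_symmetric_derivative[OF assms(1) x this]
    have "partial_deriv 1 (partial_deriv 2 H) x = partial_deriv 2 (partial_deriv 1 H) x"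
      by (simp add: partial_deriv_def[abs_def])
    moreover have "partial_deriv 2 (\<lambda>y. - partial_deriv 1 H y) x = - partial_deriv 2 (partial_deriv 1 H) x"
      unfolding partial_deriv_def[of 2]
      using frechet_derivative_at[OF has_derivative_minus[OF C1_on_has_derivative[OF C1_partial[OF assms(7)] x]]]
      by (metis (no_types))
    ultimately show ?thesis by (simp add: divergence_def sum_2 N_nth)
  qed

  \<comment> \<open>The sign \<open>\<sigma>\<close> records whether \<open>V\<close> or its
    negative is subharmonic, so that one argument serves both cases.\<close>
  have "\<exists>\<sigma>. \<bar>\<sigma>\<bar> = 1 \<and> (\<forall>x\<in>D. \<sigma> * divergence W x > 0)"
    using assms(9)
  proof
    assume sub: "strictly_subharmonic_on D g V"
    have "divergence W x > 0" if "x \<in> D" for x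
      using sub that d[OF that]
      by (auto simp: strictly_subharmonic_on_def laplace_beltrami_def W_def[abs_def] sqrt_det_g zero_less_divide_iff
          dest!: bspec[of D _ x])
    then show ?thesis by (intro exI[of _ 1]) simp
  next
    assume sub: "strictly_subharmonic_on D g (\<lambda>x. - V x)"
    have "divergence W x < 0" if "x \<in> D" for x
    proof -
      have V: "V differentiable (at y)" if "y \<in> D" for y
        using assms(6)[unfolded smooth_on_def, THEN spec, of 1] that by (simp add: C_k_on.simps)
      have "grad (\<lambda>x. - V x) y = - grad V y" if "y \<in> D" for y
        using V[OF that] by (rule grad_minus)
      \<comment> \<open>The gradient identity is established on \<open>D\<close> only; since the
        divergence at \<open>x\<close> is local and \<open>D\<close> is open, this suffices.\<close>
      then have "divergence (\<lambda>y. (- 1) *\<^sub>R W y) x =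
          divergence (\<lambda>y. sqrt (det (g y)) *\<^sub>R (matrix_inv (g y) *v grad (\<lambda>x. - V x) y)) x"
        using that C1_on_differentiable[OF C1_on_minus[OF C1_W] that]
        by (intro divergence_cong[OF assms(1)])
          (simp_all add: W_def[abs_def] linear_neg[OF matrix_vector_mul_linear])
      moreover have "divergence (\<lambda>y. (- 1) *\<^sub>R W y) x = - divergence W x"
        using divergence_scaleR[OF C1_on_differentiable[OF C1_W that], of "- 1"] by simp
      moreover have "laplace_beltrami g (\<lambda>x. - V x) x > 0"
        using sub that by (simp add: strictly_subharmonic_on_def)
      ultimately show ?thesis
        using d[OF that] by (simp add: laplace_beltrami_def sqrt_det_g[OF that] zero_less_divide_iff divide_less_0_iff)
    qed
    then show ?thesis by (intro exI[of _ "- 1"]) simp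
  qed
  then obtain \<sigma> where \<sigma>: "\<bar>\<sigma>\<bar> = 1" "\<And>x. x \<in> D \<Longrightarrow> \<sigma> * divergence W x > 0" by blast
  have \<sigma>\<sigma>: "\<sigma> * \<sigma> = 1" using \<sigma>(1) by (metis abs_mult_self_eq mult_1)

  \<comment> \<open>Writing the sign as \<open>d y / \<bar>d y\<bar>\<close> exhibits it as a
    continuously differentiable factor.\<close>
  have C1_sgn_N: "C1_on (\<lambda>y. sgn (d y) *\<^sub>R N y) D"
  proof -
    have "C1_on (\<lambda>y. (d y * inverse \<bar>d y\<bar>) *\<^sub>R N y) D"
      using d by (intro C1_on_scaleR C1_on_mult C1_d C1_on_inverse C1_abs_d C1_N) auto
    then show ?thesis by (simp only: real_sgn_eq divide_inverse)
  qed
  have div_sgn_N: "divergence (\<lambda>y. sgn (d y) *\<^sub>R N y) x = 0" if x: "x \<in> D" for x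
  proof -
    \<comment> \<open>An open neighbourhood of \<open>x\<close> on which \<open>d\<close> keeps the
      sign of \<open>d x\<close>, so that the factor \<open>sgn (d y)\<close> is constant
      there.\<close>
    define U where "U = D \<inter> (\<lambda>y. d y * d x) -` {0<..}"
    have U: "open U"
      unfolding U_def using C1_on_continuous_on[OF C1_d] \<open>open D\<close>
      by (intro continuous_open_preimage continuous_intros) auto
    have xU: "x \<in> U" using x d[OF x] by (auto simp: U_def zero_less_mult_iff)
    have sgn: "sgn (d y) = sgn (d x)" if "y \<in> U" for y
      using that by (auto simp: U_def zero_less_mult_iff)
    have "divergence (\<lambda>y. sgn (d y) *\<^sub>R N y) x = divergence (\<lambda>y. sgn (d x) *\<^sub>R N y) x"
      by (rule divergence_cong[OF U xU _ C1_on_differentiable[OF C1_sgn_N x]]) (simp only: sgn)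
    then show ?thesis
      using divergence_scaleR[OF C1_on_differentiable[OF C1_N x]] div_N[OF x] by simp
  qed

  \<comment> \<open>The Dulac field: it has positive divergence and, by \<open>F_u\<close> below, is
    a nonvanishing multiple of \<open>u\<close>, hence tangent to the orbit.\<close>
  define F where "F y = \<sigma> *\<^sub>R (W y - sgn (d y) *\<^sub>R N y)" for y
  have C1_F: "C1_on F D"
    unfolding F_def[abs_def] by (intro C1_on_scaleR C1_on_const C1_on_diff C1_W C1_sgn_N)
  have div_F: "divergence F x > 0" if "x \<in> D" for x
    using \<sigma>(2)[OF that] C1_on_differentiable[OF C1_W that] C1_on_differentiable[OF C1_sgn_N that]
    unfolding F_def[abs_def]
    by (simp add: divergence_scaleR divergence_diff div_sgn_N[OF that] differentiable_diff)
  have F_u: "F y = (- \<sigma> * \<bar>d y\<bar>) *\<^sub>R u y" if "y \<in> D" for y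
    using d[OF that]
    by (simp add: F_def W_def N_def assms(8)[OF that] sqrt_det_g[OF that] J_def[symmetric] d_def[symmetric]
        algebra_simps)
  \<comment> \<open>Regularity of \<open>u\<close> is recovered by dividing \<open>F\<close> by its
    scalar factor; uniqueness of solutions rests on it.\<close>
  have C1_u: "C1_on u D"
  proof -
    have "C1_on (\<lambda>y. (- \<sigma> * inverse \<bar>d y\<bar>) *\<^sub>R F y) D"
      using d by (intro C1_on_scaleR C1_on_mult C1_on_const C1_on_inverse C1_abs_d C1_F) auto
    then show ?thesis
    proof (rule C1_on_cong[THEN iffD1, rotated 2])
      show "(- \<sigma> * inverse \<bar>d y\<bar>) *\<^sub>R F y = u y" if y: "y \<in> D" for y
      proof -
        have "(- \<sigma> * inverse \<bar>d y\<bar>) * (- \<sigma> * \<bar>d y\<bar>) = (\<sigma> * \<sigma>) * (inverse \<bar>d y\<bar> * \<bar>d y\<bar>)"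
          by (simp add: mult_ac)
        then show ?thesis using d[OF y] by (simp add: F_u[OF y] \<sigma>\<sigma>)
      qed
    qed (rule assms(1))
  qed
  have lip: "\<exists>r>0. \<exists>L. L-lipschitz_on (ball x r) u" if x: "x \<in> D" for x
  proof -
    obtain r where r: "r > 0" "cball x r \<subseteq> D"
      using \<open>open D\<close> x open_contains_cball by blast
    obtain u' where u': "\<And>x. x \<in> D \<Longrightarrow> (u has_derivative blinfun_apply (u' x)) (at x)" "continuous_on D u'"
      using C1_on_blinfun_derivative[OF C1_u] by blast
    obtain L where "L-lipschitz_on (cball x r) u"
      using C1_lipschitz_on_compact[OF \<open>open D\<close> compact_cball r(2) u'] by blast
    then show ?thesis using r(1) lipschitz_on_subset[OF _ ball_subset_cball] by blast
  qed
  \<comment> \<open>The period \<open>T\<close> may run through the orbit several times;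
    \<open>T0\<close> runs through it once, which gives a simple closed curve.\<close>
  obtain T0 where T0: "T0 > 0" "\<And>t. \<gamma> (t + T0) = \<gamma> t" "inj_on \<gamma> {0..<T0}"
    using periodic_solution_inj[OF lip \<gamma> T nonconst] by blast
  have cont_\<gamma>: "continuous_on UNIV \<gamma>"
    by (meson continuous_at_imp_continuous_on has_vector_derivative_continuous \<gamma>(1))
  obtain R where R: "open R" "bounded R" "R \<noteq> {}" "frontier R \<subseteq> range \<gamma>" "R \<subseteq> D"
    using region_inside_closed_curve[OF assms(2) \<gamma>(2) cont_\<gamma> T0] by blast
  obtain F' where F': "\<And>x. x \<in> D \<Longrightarrow> (F has_derivative blinfun_apply (F' x)) (at x)" "continuous_on D F'"
    "\<And>x. x \<in> D \<Longrightarrow> (\<Sum>i\<in>UNIV. F' x (axis i 1) $ i) = divergence F x"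
    using C1_on_blinfun_derivative[OF C1_F] by blast
  \<comment> \<open>The velocity of the orbit is \<open>u (\<gamma> t)\<close>, and the tangency
    factor is the scalar in \<open>F_u\<close> evaluated along the orbit.\<close>
  show False
  proof (rule no_region_bounded_by_integral_curve[OF assms(1) R(5) \<gamma>(2) R(1-4) T0(1,2) \<gamma>(1) _ F'(1,2)])
    show "continuous_on UNIV (\<lambda>t. u (\<gamma> t))"
      using \<gamma>(2) by (intro continuous_on_compose2[OF C1_on_continuous_on[OF C1_u] cont_\<gamma>])
    show "(\<Sum>i\<in>UNIV. F' x (axis i 1) $ i) > 0" if "x \<in> D" for x
      using F'(3) div_F that by simp
    show "F (\<gamma> t) = (- \<sigma> * \<bar>d (\<gamma> t)\<bar>) *\<^sub>R u (\<gamma> t)" for t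
      using \<gamma>(2) by (intro F_u) auto
    show "continuous_on UNIV (\<lambda>t. - \<sigma> * \<bar>d (\<gamma> t)\<bar>)"
      using \<gamma>(2) by (intro continuous_intros continuous_on_compose2[OF C1_on_continuous_on[OF C1_d] cont_\<gamma>])
  qed
qed

end
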